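(* Suppose the standing assumptions (A1)–(A4) and the assumption (T) stated in the context hold, let $(\bm{x}^k)_{k\in\mathbb{N}}$ be generated by the algorithm BIBPA described in the context, and let each $h_i$ ($i=1,\dots,N$) be $\sigma_i$-block strongly convex ($\sigma_i>0$). If, for $i=1,\dots,N$, $\lim_{k\to\infty}\alpha_i^k=\alpha_i$, $0<\gamma_i\le\frac{\sigma_i-2|\alpha_i|}{\sigma_iL_i}$, and $$|\alpha_i^k|<\frac{\sigma_i}{2},\qquad 0<\gamma_i\le\gamma_i^k\le\frac{\sigma_i-2|\alpha_i^k|}{\sigma_iL_i},\qquad \frac{|\alpha_i^k|}{\sigma_i\gamma_i^k}\le\delta_i\le\frac{1-\gamma_i^kL_i}{\gamma_i^k}-\frac{|\alpha_i^k|}{\sigma_i\gamma_i^k},$$ then, setting $a_i:=\frac{1-\gamma_i^kL_i}{\gamma_i^k}-\frac{|\alpha_i^k|}{\sigma_i\gamma_i^k}-\delta_i$ and $b_i:=\delta_i-\frac{|\alpha_i^k|}{\sigma_i\gamma_i^k}$ for $i=1,\dots,N$, and $\mathcal{L}^k:=\mathcal{L}(\bm{x}^k,\bm{x}^{k-1})$ with $\mathcal{L}$ the Lyapunov function of the context (built with these $\delta_i$), we have $$\mathcal{L}^{k+1}-\mathcal{L}^k\le-\sum_{i=1}^N\left(a_iD_{h_i}(\bm{x}^{k,i},\bm{x}^{k,i-1})+b_iD_{h_i}(\bm{x}^{k-1,i},\bm{x}^{k-1,i-1})\right),$$ i.e. the sequence $(\mathcal{L}^k)$ is non-increasing, and consequently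 $\lim_{k\to\infty}D_{h_i}(\bm{x}^{k,i},\bm{x}^{k,i-1})=0$, i.e. $\lim_{k\to\infty}\|\bm{x}^{k,i}-\bm{x}^{k,i-1}\|=0$, for all $i=1,\dots,N$.
   Context: Notation. $\overline{\mathbb{R}}=\mathbb{R}\cup\{\infty\}$, $[N]=\{1,\dots,N\}$, $n=n_1+\dots+n_N$; $\bm{x}=(x_1,\dots,x_N)\in\mathbb{R}^n$ with $x_i\in\mathbb{R}^{n_i}$. Write $I_n=(U_1,\dots,U_N)$ with $U_i\in\mathbb{R}^{n\times n_i}$, so $\bm{x}+U_i(z-x_i)$ is $\bm{x}$ with its $i$-th block replaced by $z\in\mathbb{R}^{n_i}$. $\nabla_i$ is the partial gradient with respect to the $i$-th block. Block notions. Let $h:\mathbb{R}^n\to\overline{\mathbb{R}}$ be proper, lower semicontinuous (lsc), with $\mathrm{int}\,\mathrm{dom}\,h\ne\emptyset$ and $h\in C^1(\mathrm{int}\,\mathrm{dom}\,h)$. It is $i$-th block convex (strictly convex, $\sigma$-strongly convex) if $z\mapsto h(\bm{x}+U_i(z-x_i))$ is so for all $\bm{x}\in\mathrm{dom}\,h$; an $i$-th block kernel if it is $i$-th block convex and $h(\bm{x}+U_i(z-x_i))/\|z\|\to\infty$ as $\|z\|\to\infty$ for all $\bm{x}\in\mathrm{dom}\,h$; $i$-th block essentially smooth if $\|\nabla_ih(\bm{x}^k)\|\to\infty$ for every sequence in $\mathrm{int}\,\mathrm{dom}\,h$ converging to a boundary point of $\mathrm{dom}\,h$; $i$-th block Legendre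 if it is $i$-th block essentially smooth and $i$-th block strictly convex. "$h_i$ is $\sigma_i$-block strongly convex" means $\sigma_i$-strongly convex in the $i$-th block. Bregman distance: $D_h(\bm{y},\bm{x})=h(\bm{y})-h(\bm{x})-\langle\nabla h(\bm{x}),\bm{y}-\bm{x}\rangle$ if $\bm{y}\in\mathrm{dom}\,h$, $\bm{x}\in\mathrm{int}\,\mathrm{dom}\,h$, and $\infty$ otherwise. Given $i$-th block kernels $h_i$ and $L_i>0$ ($i\in[N]$), a proper lsc $f$ is $(L_1,\dots,L_N)$-smooth relative to $(h_1,\dots,h_N)$ if for each $i$ the function $z\mapsto L_ih_i(\bm{x}+U_i(z-x_i))-f(\bm{x}+U_i(z-x_i))$ is convex over all $\bm{x},\bm{x}+U_i(z-x_i)\in\mathrm{int}\,\mathrm{dom}\,h_i$. Problem: minimize $\Phi(\bm{x})=f(\bm{x})+\sum_{i=1}^Ng_i(x_i)$ over $\bm{x}\in\overline{C}$, with $C\subseteq\mathbb{R}^n$ nonempty, convex, open. Standing assumptions: (A1) each $g_i:\mathbb{R}^{n_i}\to\overline{\mathbb{R}}$ is proper and lsc; (A2) each $h_i:\mathbb{R}^n\to\overline{\mathbb{R}}$ is $i$-th block Legendre, $\mathrm{int}\,\mathrm{dom}\,h_1=\dots=\mathrm{int}\,\mathrm{dom}\,h_N$, $\overline{C}\subseteq\overline{\mathrm{dom}\,h_1}$, and $\mathrm{dom}\,g\cap C\ne\emptyset$ where $g=\sum_ig_i$; (A3) $f:\mathbb{R}^n\to\overline{\mathbb{R}}$ is $C^1$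 on $\mathrm{int}\,\mathrm{dom}\,h_1$ and $(L_1,\dots,L_N)$-smooth relative to $(h_1,\dots,h_N)$; (A4) $\mathrm{argmin}\{\Phi(\bm{x}):\bm{x}\in\overline{C}\}\ne\emptyset$. Mapping. For parameters $\gamma_i^k>0$, $\alpha_i^k\ge0$ and $\bm{x},\bm{y}\in\mathrm{int}\,\mathrm{dom}\,h_i$, $$T_i^k(\bm{x},\bm{y})=\mathop{\mathrm{argmin}}_{z\in\mathbb{R}^{n_i}}\ \left\langle\nabla_if(\bm{x})-\tfrac{\alpha_i^k}{\gamma_i^k}(x_i-y_i),\,z-x_i\right\rangle+\tfrac1{\gamma_i^k}D_{h_i}(\bm{x}+U_i(z-x_i),\bm{x})+g_i(z).$$ Assumption (T): for all $i\in[N]$, all $z\in T_i^k(\bm{x},\bm{y})$ and $\gamma_i^k\in(0,1/L_i)$, $\bm{x}+U_i(z-x_i)\in C$. Algorithm BIBPA. Start from $\bm{x}^0\in\mathrm{int}\,\mathrm{dom}\,h_1$, with the convention $\bm{x}^{-1}=\bm{x}^{-1,i}=\bm{x}^0$. For $k=0,1,\dots$: set $\bm{x}^{k,0}=\bm{x}^k$; for $i=1,\dots,N$ choose $\gamma_i^k,\alpha_i^k$ as in the claim, take $x_i^{k,i}\in T_i^k(\bm{x}^{k,i-1},\bm{x}^{k-1})$ and set $\bm{x}^{k,i}=\bm{x}^{k,i-1}+U_i(x_i^{k,i}-x_i^{k,i-1})$; set $\bm{x}^{k+1}=\bm{x}^{k,N}$. Thus $\bm{x}^{k,i}=(x_1^{k+1},\dots,x_i^{k+1},x_{i+1}^k,\dots,x_N^k)$.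 Lyapunov function, for $\delta_i\ge0$: $$\mathcal{L}(\bm{x},\bm{y})=\Phi(\bm{x})+\sum_{i=1}^N\delta_iD_{h_i}\big((x_1,\dots,x_i,y_{i+1},\dots,y_N),(x_1,\dots,x_{i-1},y_i,\dots,y_N)\big),$$ so $\mathcal{L}(\bm{x}^{k+1},\bm{x}^k)=\Phi(\bm{x}^{k+1})+\sum_i\delta_iD_{h_i}(\bm{x}^{k,i},\bm{x}^{k,i-1})$.
   Formalization: The limits for block i are claimed only when a_i at step k plus b_i at step k+1 is bounded below by some c>0 for all large k. Without this they can fail: N=n=1, C=R, f=h=x²/2, g the indicator of {-1,1}, γ=L=σ=1, α=δ=0 admits x^k=(-1)^k. *)

theory Defs
  imports "HOL-Analysis.Analysis"
begin

section \<open>Block structure\<close>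

text \<open>
  The coordinates of $R^n$ are indexed by a finite type, and a map \<open>blk\<close> from indices to block numbers
  partitions them into the blocks $1, \ldots, N$.  The space $R^{n_i}$ is identified with its image
  under $U_i$, the coordinate subspace \<open>block_space blk i\<close>; thus \<open>part blk i x\<close> is $U_i x_i$ and
  \<open>replace_block blk i x z\<close> is $x + U_i (z - x_i)$.  Inner products and norms are preserved.
\<close>

definition block_space :: "('n \<Rightarrow> nat) \<Rightarrow> nat \<Rightarrow> (real^'n) set" where
  "block_space blk i = {z. \<forall>j. blk j \<noteq> i \<longrightarrow> z $ j = 0}"

definition part :: "('n \<Rightarrow> nat) \<Rightarrow> nat \<Rightarrow> real^'n \<Rightarrow> real^'n" where
  "part blk i x = (\<chi> j. if blk j = i then x $ j else 0)"

definition replace_block :: "('n \<Rightarrow> nat) \<Rightarrow> nat \<Rightarrow> real^'n \<Rightarrow> real^'n \<Rightarrow> real^'n" where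
  "replace_block blk i x z = x + (z - part blk i x)"

text \<open>\<open>mix blk i x y\<close> is $(x_1, \ldots, x_i, y_{i+1}, \ldots, y_N)$.\<close>

definition mix :: "('n \<Rightarrow> nat) \<Rightarrow> nat \<Rightarrow> real^'n \<Rightarrow> real^'n \<Rightarrow> real^'n" where
  "mix blk i x y = (\<chi> j. if blk j \<le> i then x $ j else y $ j)"

section \<open>Extended-valued functions\<close>

text \<open>
  Functions into $R \cup \{\infty\}$ are \<open>ereal\<close>-valued; the value $-\infty$ is excluded by \<open>proper_on\<close>.
  The carrier \<open>S\<close> is needed because a function on $R^{n_i}$ is only meaningful on \<open>block_space blk i\<close>.
\<close>

definition edom :: "('a \<Rightarrow> ereal) \<Rightarrow> 'a set" where
  "edom h = {x. h x < \<infinity>}"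

definition proper_on :: "'a set \<Rightarrow> ('a \<Rightarrow> ereal) \<Rightarrow> bool" where
  "proper_on S h \<longleftrightarrow> (\<forall>x\<in>S. h x \<noteq> -\<infinity>) \<and> (\<exists>x\<in>S. h x < \<infinity>)"

definition lsc_on :: "'a::topological_space set \<Rightarrow> ('a \<Rightarrow> ereal) \<Rightarrow> bool" where
  "lsc_on S h \<longleftrightarrow> (\<forall>x\<in>S. h x \<le> Liminf (at x within S) h)"

definition econvex_on :: "'a::real_vector set \<Rightarrow> ('a \<Rightarrow> ereal) \<Rightarrow> bool" where
  "econvex_on S \<phi> \<longleftrightarrow> convex S \<and>
     (\<forall>u\<in>S. \<forall>v\<in>S. \<forall>t\<in>{0<..<1}.
        \<phi> ((1 - t) *\<^sub>R u + t *\<^sub>R v) \<le> ereal (1 - t) * \<phi> u + ereal t * \<phi> v)"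

definition strictly_econvex_on :: "'a::real_vector set \<Rightarrow> ('a \<Rightarrow> ereal) \<Rightarrow> bool" where
  "strictly_econvex_on S \<phi> \<longleftrightarrow> econvex_on S \<phi> \<and>
     (\<forall>u\<in>S \<inter> edom \<phi>. \<forall>v\<in>S \<inter> edom \<phi>. \<forall>t\<in>{0<..<1}. u \<noteq> v \<longrightarrow>
        \<phi> ((1 - t) *\<^sub>R u + t *\<^sub>R v) < ereal (1 - t) * \<phi> u + ereal t * \<phi> v)"

definition strongly_econvex_on :: "real \<Rightarrow> 'a::real_normed_vector set \<Rightarrow> ('a \<Rightarrow> ereal) \<Rightarrow> bool" where
  "strongly_econvex_on \<sigma> S \<phi> \<longleftrightarrow> convex S \<and>
     (\<forall>u\<in>S. \<forall>v\<in>S. \<forall>t\<in>{0<..<1}.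
        \<phi> ((1 - t) *\<^sub>R u + t *\<^sub>R v) + ereal (\<sigma> / 2 * t * (1 - t) * (norm (u - v))\<^sup>2)
          \<le> ereal (1 - t) * \<phi> u + ereal t * \<phi> v)"

text \<open>As usual, the minimizer set of a function that is identically $\infty$ is empty.\<close>

definition argmin_set :: "'a set \<Rightarrow> ('a \<Rightarrow> ereal) \<Rightarrow> 'a set" where
  "argmin_set S \<phi> = {z. is_arg_min \<phi> (\<lambda>w. w \<in> S) z \<and> \<phi> z < \<infinity>}"

definition grad :: "('a::real_inner \<Rightarrow> ereal) \<Rightarrow> 'a \<Rightarrow> 'a" where
  "grad h x = (THE d. GDERIV (\<lambda>u. real_of_ereal (h u)) x :> d)"

definition C1_on :: "'a::real_inner set \<Rightarrow> ('a \<Rightarrow> ereal) \<Rightarrow> bool" where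
  "C1_on S h \<longleftrightarrow> (\<forall>x\<in>S. \<bar>h x\<bar> \<noteq> \<infinity>) \<and>
     (\<forall>x\<in>S. GDERIV (\<lambda>u. real_of_ereal (h u)) x :> grad h x) \<and> continuous_on S (grad h)"

definition bregman :: "('a::real_inner \<Rightarrow> ereal) \<Rightarrow> 'a \<Rightarrow> 'a \<Rightarrow> ereal" where
  "bregman h y x =
     (if y \<in> edom h \<and> x \<in> interior (edom h)
      then h y - h x - ereal (grad h x \<bullet> (y - x)) else \<infinity>)"

section \<open>Block notions\<close>

definition regular :: "(real^'n \<Rightarrow> ereal) \<Rightarrow> bool" where
  "regular h \<longleftrightarrow> proper_on UNIV h \<and> lsc_on UNIV h \<and>
     interior (edom h) \<noteq> {} \<and> C1_on (interior (edom h)) h"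

definition block_convex :: "('n \<Rightarrow> nat) \<Rightarrow> nat \<Rightarrow> (real^'n \<Rightarrow> ereal) \<Rightarrow> bool" where
  "block_convex blk i h \<longleftrightarrow> regular h \<and>
     (\<forall>x\<in>edom h. econvex_on (block_space blk i) (\<lambda>z. h (replace_block blk i x z)))"

definition block_strictly_convex :: "('n \<Rightarrow> nat) \<Rightarrow> nat \<Rightarrow> (real^'n \<Rightarrow> ereal) \<Rightarrow> bool" where
  "block_strictly_convex blk i h \<longleftrightarrow> regular h \<and>
     (\<forall>x\<in>edom h. strictly_econvex_on (block_space blk i) (\<lambda>z. h (replace_block blk i x z)))"

definition block_strongly_convex ::
  "('n \<Rightarrow> nat) \<Rightarrow> nat \<Rightarrow> real \<Rightarrow> (real^'n \<Rightarrow> ereal) \<Rightarrow> bool" where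
  "block_strongly_convex blk i \<sigma> h \<longleftrightarrow> regular h \<and>
     (\<forall>x\<in>edom h. strongly_econvex_on \<sigma> (block_space blk i) (\<lambda>z. h (replace_block blk i x z)))"

definition block_kernel :: "('n \<Rightarrow> nat) \<Rightarrow> nat \<Rightarrow> (real^'n \<Rightarrow> ereal) \<Rightarrow> bool" where
  "block_kernel blk i h \<longleftrightarrow> block_convex blk i h \<and>
     (\<forall>x\<in>edom h. ((\<lambda>z. h (replace_block blk i x z) / ereal (norm z)) \<longlongrightarrow> \<infinity>)
        (inf at_infinity (principal (block_space blk i))))"

definition block_ess_smooth :: "('n \<Rightarrow> nat) \<Rightarrow> nat \<Rightarrow> (real^'n \<Rightarrow> ereal) \<Rightarrow> bool" where
  "block_ess_smooth blk i h \<longleftrightarrow> regular h \<and>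
     (\<forall>s p. (\<forall>k. s k \<in> interior (edom h)) \<longrightarrow> p \<in> frontier (edom h) \<longrightarrow> s \<longlonglongrightarrow> p \<longrightarrow>
        filterlim (\<lambda>k. norm (part blk i (grad h (s k)))) at_top sequentially)"

definition block_legendre :: "('n \<Rightarrow> nat) \<Rightarrow> nat \<Rightarrow> (real^'n \<Rightarrow> ereal) \<Rightarrow> bool" where
  "block_legendre blk i h \<longleftrightarrow> block_ess_smooth blk i h \<and> block_strictly_convex blk i h"

definition relatively_smooth ::
  "('n \<Rightarrow> nat) \<Rightarrow> nat \<Rightarrow> (nat \<Rightarrow> real) \<Rightarrow> (nat \<Rightarrow> real^'n \<Rightarrow> ereal) \<Rightarrow> (real^'n \<Rightarrow> ereal) \<Rightarrow> bool" where
  "relatively_smooth blk N L h f \<longleftrightarrow>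
     (\<forall>i\<in>{1..N}. block_kernel blk i (h i) \<and> L i > 0) \<and> proper_on UNIV f \<and> lsc_on UNIV f \<and>
     (\<forall>i\<in>{1..N}. \<forall>x\<in>interior (edom (h i)).
        econvex_on {z \<in> block_space blk i. replace_block blk i x z \<in> interior (edom (h i))}
          (\<lambda>z. ereal (L i) * h i (replace_block blk i x z) - f (replace_block blk i x z)))"

section \<open>Objective, mapping, algorithm and Lyapunov function\<close>

definition gsum ::
  "('n \<Rightarrow> nat) \<Rightarrow> nat \<Rightarrow> (nat \<Rightarrow> real^'n \<Rightarrow> ereal) \<Rightarrow> real^'n \<Rightarrow> ereal" where
  "gsum blk N g x = (\<Sum>i=1..N. g i (part blk i x))"

definition objective ::
  "('n \<Rightarrow> nat) \<Rightarrow> nat \<Rightarrow> (real^'n \<Rightarrow> ereal) \<Rightarrow> (nat \<Rightarrow> real^'n \<Rightarrow> ereal) \<Rightarrow> real^'n \<Rightarrow> ereal" where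
  "objective blk N f g x = f x + gsum blk N g x"

text \<open>
  Outside \<open>x \<in> interior (edom hi)\<close> the Bregman term is $\infty$ for every \<open>z\<close>, so the mapping is empty.
\<close>

definition prox_map ::
  "('n \<Rightarrow> nat) \<Rightarrow> nat \<Rightarrow> (real^'n \<Rightarrow> ereal) \<Rightarrow> (real^'n \<Rightarrow> ereal) \<Rightarrow> (real^'n \<Rightarrow> ereal) \<Rightarrow>
     real \<Rightarrow> real \<Rightarrow> real^'n \<Rightarrow> real^'n \<Rightarrow> (real^'n) set" where
  "prox_map blk i f gi hi \<gamma> \<alpha> x y = argmin_set (block_space blk i)
     (\<lambda>z. ereal ((part blk i (grad f x) - (\<alpha> / \<gamma>) *\<^sub>R (part blk i x - part blk i y))
                    \<bullet> (z - part blk i x))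
          + ereal (1 / \<gamma>) * bregman hi (replace_block blk i x z) x + gi z)"

text \<open>
  \<open>X k i\<close> is $x^{k,i}$ for $0 \le i \le N$, so $x^k$ is \<open>X k 0\<close>; \<open>lag X k i\<close> is $x^{k-1,i}$ with the
  convention $x^{-1,i} = x^{-1} = x^0$.
\<close>

definition lag :: "(nat \<Rightarrow> nat \<Rightarrow> 'a) \<Rightarrow> nat \<Rightarrow> nat \<Rightarrow> 'a" where
  "lag X k i = (case k of 0 \<Rightarrow> X 0 0 | Suc m \<Rightarrow> X m i)"

definition bibpa ::
  "('n \<Rightarrow> nat) \<Rightarrow> nat \<Rightarrow> (real^'n \<Rightarrow> ereal) \<Rightarrow> (nat \<Rightarrow> real^'n \<Rightarrow> ereal) \<Rightarrow>
     (nat \<Rightarrow> real^'n \<Rightarrow> ereal) \<Rightarrow> (nat \<Rightarrow> nat \<Rightarrow> real) \<Rightarrow> (nat \<Rightarrow> nat \<Rightarrow> real) \<Rightarrow>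
     (nat \<Rightarrow> nat \<Rightarrow> real^'n) \<Rightarrow> bool" where
  "bibpa blk N f g h \<gamma> \<alpha> X \<longleftrightarrow>
     X 0 0 \<in> interior (edom (h 1)) \<and>
     (\<forall>k. \<forall>i\<in>{1..N}.
        \<exists>z\<in>prox_map blk i f (g i) (h i) (\<gamma> i k) (\<alpha> i k) (X k (i - 1)) (lag X k 0).
          X k i = replace_block blk i (X k (i - 1)) z) \<and>
     (\<forall>k. X (Suc k) 0 = X k N)"

definition lyapunov ::
  "('n \<Rightarrow> nat) \<Rightarrow> nat \<Rightarrow> (real^'n \<Rightarrow> ereal) \<Rightarrow> (nat \<Rightarrow> real^'n \<Rightarrow> ereal) \<Rightarrow>
     (nat \<Rightarrow> real^'n \<Rightarrow> ereal) \<Rightarrow> (nat \<Rightarrow> real) \<Rightarrow> real^'n \<Rightarrow> real^'n \<Rightarrow> ereal" where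
  "lyapunov blk N f g h \<delta> x y = objective blk N f g x +
     (\<Sum>i=1..N. ereal (\<delta> i) * bregman (h i) (mix blk i x y) (mix blk (i - 1) x y))"

text \<open>The coefficients $a_i$ and $b_i$ of one block depend on the iteration through $\gamma_i^k$ and $\alpha_i^k$.
  They are nonnegative under the parameter rules, but both may vanish.  Summing the descent
  inequality gives the term $D_{h_i}(x^{k,i}, x^{k,i-1})$ the total weight $a_i^k + b_i^{k+1}$, so it
  forces this term to $0$ only if that weight stays bounded away from $0$.  Without such a bound the
  limit can fail: for $N = n = 1$, $f = h = x^2/2$, $g$ the indicator of $\{-1, 1\}$,
  $\gamma = L = \sigma = 1$ and $\alpha = \delta = 0$, the iterates $x^k = (-1)^k$ are admissible.\<close>

definition coeff_a :: "real \<Rightarrow> real \<Rightarrow> real \<Rightarrow> real \<Rightarrow> real \<Rightarrow> real" where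
  "coeff_a \<sigma> L \<delta> \<gamma> \<alpha> = (1 - \<gamma> * L) / \<gamma> - \<bar>\<alpha>\<bar> / (\<sigma> * \<gamma>) - \<delta>"

definition coeff_b :: "real \<Rightarrow> real \<Rightarrow> real \<Rightarrow> real \<Rightarrow> real" where
  "coeff_b \<sigma> \<delta> \<gamma> \<alpha> = \<delta> - \<bar>\<alpha>\<bar> / (\<sigma> * \<gamma>)"

end

theory Submission
  imports Defs
begin

text \<open>
  Since a minimizer of the subproblem has a finite value, the mere existence of the next iterate puts
  every $x^{k,i}$ into the interior of the domain.  Comparing the minimizer with the old block, and
  using relative smoothness for $f$, gives
  $\Phi(x^{k,i}) - \Phi(x^{k,i-1}) \le (L_i - 1/\gamma) D + (\alpha/\gamma) \langle p, d \rangle$ with $D$ the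
  Bregman distance of the update, $d$ the update and $p$ the previous update of the same block.  Young's
  inequality and strong convexity split the inner product into a multiple of $D$ and the same
  multiple of the previous Bregman distance, and the Lyapunov function absorbs the latter.

  For the limit, $\Phi$ is bounded below only on the closure of $C$, and $x^{k+1}$ may leave $C$ if a
  later block uses the step size $1/L_j$.  A positive weight on block $i$ forces
  $\gamma_i^k < 1/L_i$, hence $x^{k,i} \in C$, and the Lyapunov value at $x^k$ dominates
  $\Phi(x^{k,i})$ because the descent holds block by block.
\<close>

text \<open>Divide the secant inequality by \<open>t\<close> and let \<open>t\<close> tend to 0 from
  the right; the gain survives as \<open>\<kappa>\<close> because \<open>1 - t\<close> tends to 1.
  Strong convexity uses \<sigma>/2 times the squared step length for \<open>\<kappa>\<close>,
  relative smoothness uses 0.\<close>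

lemma gderiv_convex_secant:
  fixes F :: "'a::real_inner \<Rightarrow> real"
  assumes der: "GDERIV F x :> D"
    and le: "\<And>t. t \<in> {0<..<1} \<Longrightarrow> F (x + t *\<^sub>R d) + \<kappa> * t * (1 - t) \<le> (1 - t) * F x + t * c"
  shows "D \<bullet> d + \<kappa> \<le> c - F x"
proof -
  have "((\<lambda>t. F (x + t *\<^sub>R d)) has_derivative (\<lambda>t. D \<bullet> (t *\<^sub>R d))) (at 0)"
  proof -
    have "(F has_derivative (\<lambda>v. D \<bullet> v)) (at (x + 0 *\<^sub>R d))"
      using der unfolding gderiv_def by (simp add: inner_commute)
    moreover have "((\<lambda>t. x + t *\<^sub>R d) has_derivative (\<lambda>t. t *\<^sub>R d)) (at 0)"
      by (auto intro!: derivative_eq_intros)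
    ultimately show ?thesis
      using has_derivative_compose by blast
  qed
  then have "((\<lambda>t. F (x + t *\<^sub>R d)) has_field_derivative (D \<bullet> d)) (at 0)"
    unfolding has_field_derivative_def by (simp add: mult.commute[of _ "D \<bullet> d"])
  then have "((\<lambda>t. (F (x + t *\<^sub>R d) - F x) / t) \<longlongrightarrow> D \<bullet> d) (at_right 0)"
    unfolding DERIV_def by (auto intro: filterlim_mono at_le)
  then have "((\<lambda>t. (F (x + t *\<^sub>R d) - F x) / t + \<kappa> * (1 - t)) \<longlongrightarrow> D \<bullet> d + \<kappa> * (1 - 0)) (at_right 0)"
    by (intro tendsto_intros)
  moreover have "\<forall>\<^sub>F t in at_right 0. (F (x + t *\<^sub>R d) - F x) / t + \<kappa> * (1 - t) \<le> c - F x"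
    unfolding eventually_at_right_field
  proof (intro exI[of _ 1] conjI allI impI)
    fix t :: real assume t: "0 < t" "t < 1"
    have "F (x + t *\<^sub>R d) - F x + t * (\<kappa> * (1 - t)) \<le> t * (c - F x)"
      using le[of t] t by (simp add: algebra_simps)
    then have "((F (x + t *\<^sub>R d) - F x) + t * (\<kappa> * (1 - t))) / t \<le> c - F x"
      using t by (simp add: divide_le_eq mult.commute)
    then show "(F (x + t *\<^sub>R d) - F x) / t + \<kappa> * (1 - t) \<le> c - F x"
      using t by (simp add: add_divide_distrib)
  qed simp
  ultimately show ?thesis
    using tendsto_upperbound[of _ "D \<bullet> d + \<kappa> * (1 - 0)" "at_right (0::real)"] by simp
qed

section \<open>Block replacement and Bregman distances\<close>

lemma part_in_block_space: "part blk i x \<in> block_space blk i"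
  by (simp add: part_def block_space_def)

lemma replace_block_nth:
  assumes "z \<in> block_space blk i"
  shows "replace_block blk i x z $ c = (if blk c = i then z $ c else x $ c)"
  using assms by (auto simp: replace_block_def part_def block_space_def)

lemma replace_block_part [simp]: "replace_block blk i x (part blk i x) = x"
  by (simp add: replace_block_def)

lemma part_replace_block:
  assumes "z \<in> block_space blk i"
  shows "part blk j (replace_block blk i x z) = (if j = i then z else part blk j x)"
  using assms by (auto simp: vec_eq_iff part_def replace_block_nth) (auto simp: block_space_def)

text \<open>Moving inside one block traces a straight segment of the full space, so block convexity
  can be differentiated with the full gradient.\<close>

lemma replace_block_segment:
  "replace_block blk i x ((1 - t) *\<^sub>R part blk i x + t *\<^sub>R z)
     = x + t *\<^sub>R (replace_block blk i x z - x)"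
  by (simp add: replace_block_def algebra_simps)

lemma regular_finite:
  assumes "regular h" "x \<in> edom h"
  shows "\<bar>h x\<bar> \<noteq> \<infinity>"
  using assms by (auto simp: regular_def proper_on_def edom_def)

lemma C1_on_finite:
  assumes "C1_on S f" "x \<in> S"
  shows "\<bar>f x\<bar> \<noteq> \<infinity>"
  using assms unfolding C1_on_def by simp

lemma regular_gderiv:
  assumes "regular h" "x \<in> interior (edom h)"
  shows "GDERIV (\<lambda>u. real_of_ereal (h u)) x :> grad h x"
  using assms by (auto simp: regular_def C1_on_def)

lemma bregman_eq:
  assumes "regular h" "x \<in> interior (edom h)" "y \<in> edom h"
  shows "bregman h y x = ereal (real_of_ereal (h y) - real_of_ereal (h x) - grad h x \<bullet> (y - x))"
proof -
  have "x \<in> edom h" using assms(2) interior_subset by blast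
  then have "\<bar>h x\<bar> \<noteq> \<infinity>" "\<bar>h y\<bar> \<noteq> \<infinity>"
    using regular_finite[OF assms(1)] assms(3) by simp_all
  then obtain a b where "h x = ereal a" "h y = ereal b" by auto
  then show ?thesis using assms by (simp add: bregman_def)
qed

text \<open>Follows from the secant lemma along the block segment. It trades squared step lengths
  for Bregman distances, both to absorb the inertial term and to obtain the norm limit at the
  end.\<close>

lemma bregman_strongly_convex:
  assumes sc: "block_strongly_convex blk i \<sigma> h"
    and x: "x \<in> interior (edom h)" and z: "z \<in> block_space blk i"
    and y: "replace_block blk i x z \<in> edom h"
  shows "ereal (\<sigma> / 2 * (norm (replace_block blk i x z - x))\<^sup>2) \<le> bregman h (replace_block blk i x z) x"
proof -
  let ?y = "replace_block blk i x z"
  have reg: "regular h" using sc by (simp add: block_strongly_convex_def)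
  have xe: "x \<in> edom h" using x interior_subset by blast
  obtain a b where ab: "h x = ereal a" "h ?y = ereal b"
    using regular_finite[OF reg xe] regular_finite[OF reg y] by auto
  have nm: "norm (part blk i x - z) = norm (?y - x)"
    by (simp add: replace_block_def norm_minus_commute)
  have "grad h x \<bullet> (?y - x) + \<sigma> / 2 * (norm (?y - x))\<^sup>2 \<le> b - real_of_ereal (h x)"
  proof (rule gderiv_convex_secant[OF regular_gderiv[OF reg x]])
    fix t :: real assume t: "t \<in> {0<..<1}"
    have "h (replace_block blk i x ((1 - t) *\<^sub>R part blk i x + t *\<^sub>R z))
           + ereal (\<sigma> / 2 * t * (1 - t) * (norm (part blk i x - z))\<^sup>2)
         \<le> ereal (1 - t) * h (replace_block blk i x (part blk i x)) + ereal t * h ?y"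
      using sc xe z t part_in_block_space[of blk i x]
      unfolding block_strongly_convex_def strongly_econvex_on_def by blast
    then have *: "h (x + t *\<^sub>R (?y - x)) + ereal (\<sigma> / 2 * t * (1 - t) * (norm (?y - x))\<^sup>2)
         \<le> ereal ((1 - t) * a + t * b)"
      by (simp add: replace_block_segment nm ab)
    \<comment> \<open>\<open>real_of_ereal\<close> sends infinite values to 0, so finiteness is
      needed before passing to reals: the convexity inequality bounds the value above, properness
      excludes minus infinity.\<close>
    moreover have "h (x + t *\<^sub>R (?y - x)) \<noteq> -\<infinity>"
      using reg by (auto simp: regular_def proper_on_def)
    ultimately obtain r where "h (x + t *\<^sub>R (?y - x)) = ereal r"
      by (cases "h (x + t *\<^sub>R (?y - x))") auto
    with * show "real_of_ereal (h (x + t *\<^sub>R (?y - x))) + \<sigma> / 2 * (norm (?y - x))\<^sup>2 * t * (1 - t)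
        \<le> (1 - t) * real_of_ereal (h x) + t * b"
      by (simp add: ab algebra_simps)
  qed
  then show ?thesis using bregman_eq[OF reg x y] by (simp add: ab)
qed

text \<open>This is the first-order inequality of the convex function \<open>L * h - f\<close> on
  the block, rearranged so that the terms in \<open>h\<close> form a Bregman distance.\<close>

lemma relatively_smooth_descent:
  assumes reg: "regular h" and f: "C1_on (interior (edom h)) f"
    and conv: "econvex_on {z \<in> block_space blk i. replace_block blk i x z \<in> interior (edom h)}
          (\<lambda>z. ereal L * h (replace_block blk i x z) - f (replace_block blk i x z))"
    and x: "x \<in> interior (edom h)" and z: "z \<in> block_space blk i"
    and y: "replace_block blk i x z \<in> interior (edom h)"
  shows "real_of_ereal (f (replace_block blk i x z)) \<le> real_of_ereal (f x)
      + grad f x \<bullet> (replace_block blk i x z - x) + L * real_of_ereal (bregman h (replace_block blk i x z) x)"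
proof -
  let ?y = "replace_block blk i x z"
  let ?S = "{z \<in> block_space blk i. replace_block blk i x z \<in> interior (edom h)}"
  let ?F = "\<lambda>u. L * real_of_ereal (h u) - real_of_ereal (f u)"
  have fin: "ereal L * h u - f u = ereal (?F u)" if "u \<in> interior (edom h)" for u
  proof -
    have "\<bar>h u\<bar> \<noteq> \<infinity>" "\<bar>f u\<bar> \<noteq> \<infinity>"
      using C1_on_finite[OF f] C1_on_finite[of "interior (edom h)" h] reg that
      by (simp_all add: regular_def)
    then obtain a b where "h u = ereal a" "f u = ereal b" by auto
    then show ?thesis by simp
  qed
  have "GDERIV (\<lambda>u. real_of_ereal (f u)) x :> grad f x"
    using f x by (simp add: C1_on_def)
  with regular_gderiv[OF reg x] have der: "GDERIV ?F x :> L *\<^sub>R grad h x - grad f x"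
    unfolding gderiv_def by (auto intro!: derivative_eq_intros simp: inner_diff_right fun_eq_iff)
  have "(L *\<^sub>R grad h x - grad f x) \<bullet> (?y - x) + 0 \<le> ?F ?y - ?F x"
  proof (rule gderiv_convex_secant[OF der])
    fix t :: real assume t: "t \<in> {0<..<1}"
    let ?w = "(1 - t) *\<^sub>R part blk i x + t *\<^sub>R z"
    have S: "part blk i x \<in> ?S" "z \<in> ?S"
      using x y z part_in_block_space by auto
    \<comment> \<open>Convexity of the carrier, which is part of \<open>econvex_on\<close>, keeps
      the segment in the interior, where \<open>h\<close> and \<open>f\<close> are both
      finite.\<close>
    have "?w \<in> ?S"
      using convexD_alt[of ?S "part blk i x" z t] conv S t unfolding econvex_on_def
      by (simp only: greaterThanLessThan_iff less_imp_le)
    then have "ereal L * h (replace_block blk i x ?w) - f (replace_block blk i x ?w)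
        = ereal (?F (x + t *\<^sub>R (?y - x)))"
      using fin by (simp only: replace_block_segment mem_Collect_eq)
    moreover have "ereal L * h (replace_block blk i x ?w) - f (replace_block blk i x ?w)
        \<le> ereal (1 - t) * (ereal L * h x - f x) + ereal t * (ereal L * h ?y - f ?y)"
      using conv[unfolded econvex_on_def, THEN conjunct2, rule_format, OF S t] by simp
    ultimately show "?F (x + t *\<^sub>R (?y - x)) + 0 * t * (1 - t) \<le> (1 - t) * ?F x + t * ?F ?y"
      using fin[OF x] fin[OF y] by simp
  qed
  moreover have "real_of_ereal (bregman h ?y x)
      = real_of_ereal (h ?y) - real_of_ereal (h x) - grad h x \<bullet> (?y - x)"
    using bregman_eq[OF reg x, of ?y] y interior_subset by (metis real_of_ereal.simps(1) subsetD)
  ultimately show ?thesis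
    by (simp add: inner_diff_left right_diff_distrib del: inner_diff_right)
qed

section \<open>Minimizers of the block subproblem and descent of one update\<close>

lemma prox_map_finite:
  assumes z: "z \<in> prox_map blk i f gi h \<gamma> \<alpha> x y" and "\<gamma> > 0"
    and g: "proper_on (block_space blk i) gi"
  shows "z \<in> block_space blk i" "x \<in> interior (edom h)" "replace_block blk i x z \<in> edom h"
    "\<bar>gi z\<bar> \<noteq> \<infinity>"
proof -
  show zb: "z \<in> block_space blk i"
    using z by (simp add: prox_map_def argmin_set_def is_arg_min_def)
  have gz: "gi z \<noteq> -\<infinity>" using g zb by (simp add: proper_on_def)
  have lt: "ereal r + ereal (1 / \<gamma>) * bregman h (replace_block blk i x z) x + gi z < \<infinity>"
    if "r = (part blk i (grad f x) - (\<alpha> / \<gamma>) *\<^sub>R (part blk i x - part blk i y)) \<bullet> (z - part blk i x)" for r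
    using z that by (simp add: prox_map_def argmin_set_def)
  \<comment> \<open>\<open>argmin_set\<close> admits only values below infinity, and \<gamma> > 0
    keeps an infinite Bregman term infinite after scaling.\<close>
  have "bregman h (replace_block blk i x z) x \<noteq> \<infinity>"
    using lt[OF refl] \<open>\<gamma> > 0\<close> by auto
  then show "x \<in> interior (edom h)" "replace_block blk i x z \<in> edom h"
    by (auto simp: bregman_def split: if_splits)
  show "\<bar>gi z\<bar> \<noteq> \<infinity>"
    using lt[OF refl] gz by auto
qed

lemma inner_part:
  assumes "w \<in> block_space blk i"
  shows "part blk i v \<bullet> w = v \<bullet> w"
  using assms by (auto simp: inner_vec_def part_def block_space_def intro!: sum.cong)

text \<open>The competitor is the old block, at which the linear and the Bregman term vanish. The
  inequality stays extended-valued because the old block may lie outside the domain of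
  \<open>gi\<close>.\<close>

lemma prox_map_optimal:
  assumes z: "z \<in> prox_map blk i f gi h \<gamma> \<alpha> x y" and \<gamma>: "\<gamma> > 0"
    and g: "proper_on (block_space blk i) gi" and reg: "regular h"
  shows "ereal (grad f x \<bullet> (replace_block blk i x z - x)
            - \<alpha> / \<gamma> * ((part blk i x - part blk i y) \<bullet> (replace_block blk i x z - x))
            + real_of_ereal (bregman h (replace_block blk i x z) x) / \<gamma>) + gi z
         \<le> gi (part blk i x)"
proof -
  note fin = prox_map_finite[OF z \<gamma> g]
  let ?y = "replace_block blk i x z"
  let ?v = "part blk i (grad f x) - (\<alpha> / \<gamma>) *\<^sub>R (part blk i x - part blk i y)"
  let ?\<phi> = "\<lambda>w. ereal (?v \<bullet> (w - part blk i x))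
          + ereal (1 / \<gamma>) * bregman h (replace_block blk i x w) x + gi w"
  have x: "x \<in> edom h" using fin(2) interior_subset by blast
  have "?\<phi> z \<le> ?\<phi> (part blk i x)"
    using z part_in_block_space[of blk i x]
    by (auto simp: prox_map_def argmin_set_def is_arg_min_def not_less)
  also have "?\<phi> (part blk i x) = gi (part blk i x)"
    using bregman_eq[OF reg fin(2) x] by (simp add: zero_ereal_def[symmetric])
  finally have le: "?\<phi> z \<le> gi (part blk i x)" .
  have d: "z - part blk i x = ?y - x" by (simp add: replace_block_def)
  have db: "?y - x \<in> block_space blk i"
    using fin(1) part_in_block_space[of blk i x] unfolding d[symmetric] by (simp add: block_space_def)
  have inn: "?v \<bullet> (z - part blk i x) = grad f x \<bullet> (?y - x)
            - \<alpha> / \<gamma> * ((part blk i x - part blk i y) \<bullet> (?y - x))"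
    using inner_part[OF db, of "grad f x"] by (simp add: d inner_diff_left)
  have "ereal (1 / \<gamma>) * bregman h ?y x = ereal (real_of_ereal (bregman h ?y x) / \<gamma>)"
    using bregman_eq[OF reg fin(2,3)] by simp
  with le inn show ?thesis by simp
qed

text \<open>Adds the descent inequality for \<open>f\<close> to the optimality of the subproblem.
  \<open>q\<close> majorizes the squared extrapolation step; it will be the Bregman distance of the
  previous update of the same block.\<close>

lemma block_descent:
  assumes sc: "block_strongly_convex blk i \<sigma> h" and \<sigma>: "\<sigma> > 0"
    and f: "C1_on (interior (edom h)) f"
    and conv: "\<And>x. x \<in> interior (edom h) \<Longrightarrow>
        econvex_on {z \<in> block_space blk i. replace_block blk i x z \<in> interior (edom h)}
          (\<lambda>z. ereal L * h (replace_block blk i x z) - f (replace_block blk i x z))"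
    and g: "proper_on (block_space blk i) gi"
    and \<gamma>: "\<gamma> > 0" and \<alpha>: "\<alpha> \<ge> 0"
    and z: "z \<in> prox_map blk i f gi h \<gamma> \<alpha> x y"
    and xp: "xp = replace_block blk i x z" "xp \<in> interior (edom h)"
    and q: "\<sigma> / 2 * (norm (part blk i x - part blk i y))\<^sup>2 \<le> q"
  shows "f xp + gi (part blk i xp)
           + ereal (((1 - \<gamma> * L) / \<gamma> - \<bar>\<alpha>\<bar> / (\<sigma> * \<gamma>)) * real_of_ereal (bregman h xp x)
                    - \<bar>\<alpha>\<bar> / (\<sigma> * \<gamma>) * q)
         \<le> f x + gi (part blk i x)"
proof -
  have reg: "regular h" using sc by (simp add: block_strongly_convex_def)
  note fin = prox_map_finite[OF z \<gamma> g]
  have pz: "part blk i xp = z" using fin(1) xp by (simp add: part_replace_block)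
  define p where "p = part blk i x - part blk i y"
  define d where "d = xp - x"
  define D where "D = real_of_ereal (bregman h xp x)"
  have dsc: "real_of_ereal (f xp) \<le> real_of_ereal (f x) + grad f x \<bullet> d + L * D"
    using relatively_smooth_descent[OF reg f conv[OF fin(2)] fin(2,1)] xp
    unfolding d_def D_def by simp
  have "ereal (\<sigma> / 2 * (norm d)\<^sup>2) \<le> bregman h xp x"
    using bregman_strongly_convex[OF sc fin(2,1,3)] xp by (simp add: d_def)
  then have D: "\<sigma> / 2 * (norm d)\<^sup>2 \<le> D"
    using bregman_eq[OF reg fin(2,3)] xp by (simp add: D_def)
  \<comment> \<open>Young's inequality with equal weights: after scaling by \<sigma>, the two halves
    are exactly the quantities dominated by \<open>q\<close> and \<open>D\<close>.\<close>
  have "p \<bullet> d \<le> ((norm p)\<^sup>2 + (norm d)\<^sup>2) / 2"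
    using inner_ge_zero[of "p - d"]
    by (simp add: power2_norm_eq_inner inner_diff_left inner_diff_right inner_commute)
  then have "\<sigma> * (p \<bullet> d) \<le> \<sigma> * (((norm p)\<^sup>2 + (norm d)\<^sup>2) / 2)"
    using \<sigma> by simp
  also have "\<dots> \<le> q + D" using q D unfolding p_def[symmetric] by (simp add: algebra_simps)
  finally have "\<alpha> / (\<sigma> * \<gamma>) * (\<sigma> * (p \<bullet> d)) \<le> \<alpha> / (\<sigma> * \<gamma>) * (q + D)"
    using \<alpha> \<sigma> \<gamma> by (intro mult_left_mono) auto
  then have cs: "\<alpha> / \<gamma> * (p \<bullet> d) \<le> \<alpha> / (\<sigma> * \<gamma>) * (q + D)"
    using \<sigma> by simp
  have opt: "ereal (grad f x \<bullet> d - \<alpha> / \<gamma> * (p \<bullet> d) + D / \<gamma>) + gi z \<le> gi (part blk i x)"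
    using prox_map_optimal[OF z \<gamma> g reg] xp by (simp add: p_def d_def D_def)
  obtain r where r: "gi z = ereal r" using fin(4) by auto
  obtain u v where uv: "f x = ereal u" "f xp = ereal v"
  proof -
    have "\<bar>f x\<bar> \<noteq> \<infinity>" "\<bar>f xp\<bar> \<noteq> \<infinity>"
      using C1_on_finite[OF f] fin(2) xp(2) by simp_all
    then show thesis using that by auto
  qed
  have L: "(1 - \<gamma> * L) / \<gamma> = 1 / \<gamma> - L" using \<gamma> by (simp add: field_simps)
  show ?thesis
  proof (cases "gi (part blk i x)")
    case (real s)
    then have "grad f x \<bullet> d - \<alpha> / \<gamma> * (p \<bullet> d) + D / \<gamma> + r \<le> s"
      using opt r by simp
    moreover have "(1 / \<gamma> - L - \<alpha> / (\<sigma> * \<gamma>)) * D - \<alpha> / (\<sigma> * \<gamma>) * q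
        = D / \<gamma> - L * D - \<alpha> / (\<sigma> * \<gamma>) * (q + D)"
      by (simp add: algebra_simps add_divide_distrib)
    \<comment> \<open>The estimate is linear once its products are single quantities:
      \<open>G\<close> is the gradient term, \<open>P\<close> the inertial term, \<open>Q\<close>
      its Young bound, and \<open>D'\<close>, \<open>M\<close> are \<open>D / \<gamma>\<close> and
      \<open>L * D\<close>.\<close>
    moreover have "v + r + E \<le> u + s"
      if "G - P + D' + r \<le> s" "E = D' - M - Q" "P \<le> Q" "v \<le> u + G + M" for E G P D' M Q :: real
      using that by linarith
    ultimately have "v + r + ((1 / \<gamma> - L - \<alpha> / (\<sigma> * \<gamma>)) * D - \<alpha> / (\<sigma> * \<gamma>) * q) \<le> u + s"
      using cs dsc unfolding uv real_of_ereal.simps by blast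
    with \<alpha> show ?thesis unfolding pz L D_def[symmetric] by (simp add: r uv real)
  next
    \<comment> \<open>The old block lies outside the domain of \<open>gi\<close>; as
      \<open>f x\<close> is finite, the right-hand side is infinite.\<close>
    case PInf
    then show ?thesis by (simp add: uv)
  next
    case MInf
    then show ?thesis using g part_in_block_space[of blk i x] by (simp add: proper_on_def)
  qed
qed

text \<open>The remaining summands of \<open>gsum\<close> are carried as an arbitrary \<open>rest\<close>, which may be $\infty$ before
  every block has been updated once.\<close>

lemma objective_update:
  assumes z: "z \<in> block_space blk i" and i: "i \<in> {1..N}"
    and le: "f (replace_block blk i x z) + g i (part blk i (replace_block blk i x z)) + ereal c
               \<le> f x + g i (part blk i x)"
  shows "objective blk N f g (replace_block blk i x z) + ereal c \<le> objective blk N f g x"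
proof -
  let ?y = "replace_block blk i x z"
  define rest where "rest = (\<Sum>j\<in>{1..N} - {i}. g j (part blk j x))"
  have "rest = (\<Sum>j\<in>{1..N} - {i}. g j (part blk j ?y))"
    unfolding rest_def by (intro sum.cong) (auto simp: part_replace_block[OF z])
  then have y: "gsum blk N g ?y = g i (part blk i ?y) + rest"
    using i unfolding gsum_def by (simp add: sum.remove)
  have x: "gsum blk N g x = g i (part blk i x) + rest"
    using i unfolding gsum_def rest_def by (simp add: sum.remove)
  have "f ?y + g i (part blk i ?y) + ereal c + rest \<le> f x + g i (part blk i x) + rest"
    using le by (rule add_right_mono)
  then show ?thesis unfolding objective_def x y by (simp add: ac_simps)
qed

section \<open>Intermediate points of a sweep\<close>

lemma norm_part_diff_le: "norm (part blk i x - part blk i y) \<le> norm (x - y)"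
  by (rule norm_le_componentwise_cart) (simp add: part_def)

lemma sum_ereal_neq_MInfty:
  fixes F :: "'a \<Rightarrow> ereal"
  assumes "\<And>j. j \<in> J \<Longrightarrow> F j \<noteq> -\<infinity>"
  shows "sum F J \<noteq> -\<infinity>"
  using assms by (induction J rule: infinite_finite_induct) auto

text \<open>A coordinate changes only at the step of its own block: before that step it keeps its
  value in \<open>Y 0\<close>, afterwards its value in \<open>Y (blk c)\<close>.\<close>

lemma sweep_nth:
  assumes upd: "\<And>i. i \<in> {1..N} \<Longrightarrow> \<exists>z\<in>block_space blk i. Y i = replace_block blk i (Y (i - 1)) z"
    and "1 \<le> blk c" "m \<le> N"
  shows "Y m $ c = Y (if blk c \<le> m then blk c else 0) $ c"
  using \<open>m \<le> N\<close>
proof (induction m)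
  case 0
  then show ?case using \<open>1 \<le> blk c\<close> by simp
next
  case (Suc m)
  obtain z where "z \<in> block_space blk (Suc m)" "Y (Suc m) = replace_block blk (Suc m) (Y m) z"
    using upd[of "Suc m"] Suc.prems by auto
  then have "blk c \<noteq> Suc m \<Longrightarrow> Y (Suc m) $ c = Y m $ c"
    by (simp add: replace_block_nth)
  then show ?case using Suc by (cases "blk c = Suc m") (auto simp: le_Suc_eq)
qed

text \<open>Recognizes the mixed arguments of the Lyapunov function as the intermediate iterates of
  the sweep.\<close>

lemma sweep_mix:
  assumes upd: "\<And>i. i \<in> {1..N} \<Longrightarrow> \<exists>z\<in>block_space blk i. Y i = replace_block blk i (Y (i - 1)) z"
    and "range blk = {1..N}" "m \<le> N"
  shows "mix blk m (Y N) (Y 0) = Y m"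
proof -
  have "1 \<le> blk c \<and> blk c \<le> N" for c
    using assms(2) by (metis atLeastAtMost_iff rangeI)
  then show ?thesis
    using sweep_nth[where Y = Y and m = m, OF upd _ \<open>m \<le> N\<close>]
      sweep_nth[where Y = Y and m = N, OF upd _ order.refl]
    by (simp add: vec_eq_iff mix_def)
qed

lemma sweep_part:
  assumes upd: "\<And>i. i \<in> {1..N} \<Longrightarrow> \<exists>z\<in>block_space blk i. Y i = replace_block blk i (Y (i - 1)) z"
    and i: "i \<in> {1..N}" and m: "m \<le> N"
  shows "part blk i (Y m) = part blk i (if i \<le> m then Y i else Y 0)"
proof -
  have "Y m $ c = (if i \<le> m then Y i else Y 0) $ c" if "blk c = i" for c
    using sweep_nth[where Y = Y and c = c, OF upd _ m] i that by (cases "i \<le> m") simp_all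
  then show ?thesis by (simp add: vec_eq_iff part_def)
qed

text \<open>The sequence \<open>w\<close> decreases and is bounded below, so its consecutive
  differences vanish. Each \<open>d k\<close> is paid for twice, with weight \<open>a k\<close> in
  one difference and \<open>b (Suc k)\<close> in the next; the two payments together are at least
  \<open>c * d k\<close>.\<close>

lemma weighted_decrease_tendsto_zero:
  fixes w a b d :: "nat \<Rightarrow> real"
  assumes dec: "\<And>k. w (Suc k) + (a (Suc k) * d (Suc k) + b (Suc k) * d k) \<le> w k"
    and nonneg: "\<And>k. 0 \<le> a k" "\<And>k. 0 \<le> b k" "\<And>k. 0 \<le> d k"
    and bdd: "\<forall>\<^sub>F k in sequentially. M \<le> w k"
    and c: "0 < c" "\<forall>\<^sub>F k in sequentially. c \<le> a k + b (Suc k)"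
  shows "d \<longlonglongrightarrow> 0"
proof -
  have pos: "0 \<le> a j * d k" "0 \<le> b j * d k" for j k
    using nonneg by simp_all
  have "w (Suc k) \<le> w k" for k
    using dec[of k] pos[of "Suc k" "Suc k"] pos[of "Suc k" k] by linarith
  then have "decseq w" by (rule decseq_SucI)
  obtain K where K: "\<And>k. k \<ge> K \<Longrightarrow> M \<le> w k"
    using bdd by (auto simp: eventually_sequentially)
  \<comment> \<open>An eventual lower bound of a decreasing sequence holds from the start.\<close>
  have "M \<le> w k" for k
    using K[of "max k K"] decseqD[OF \<open>decseq w\<close>, of k "max k K"] by simp
  then obtain l where l: "w \<longlonglongrightarrow> l"
    using decseq_convergent[OF \<open>decseq w\<close>] by blast
  have diff: "(\<lambda>k. w k - w (Suc k)) \<longlonglongrightarrow> 0"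
    using tendsto_diff[OF l LIMSEQ_Suc[OF l]] by simp
  have "(\<lambda>k. a (Suc k) * d (Suc k)) \<longlonglongrightarrow> 0"
  proof (rule tendsto_sandwich[OF _ _ tendsto_const diff])
    show "\<forall>\<^sub>F k in sequentially. a (Suc k) * d (Suc k) \<le> w k - w (Suc k)"
      using dec pos by (intro always_eventually allI) (smt (verit))
  qed (use pos in simp)
  then have A: "(\<lambda>k. a k * d k) \<longlonglongrightarrow> 0"
    by (rule LIMSEQ_imp_Suc)
  have B: "(\<lambda>k. b (Suc k) * d k) \<longlonglongrightarrow> 0"
  proof (rule tendsto_sandwich[OF _ _ tendsto_const diff])
    show "\<forall>\<^sub>F k in sequentially. b (Suc k) * d k \<le> w k - w (Suc k)"
      using dec pos by (intro always_eventually allI) (smt (verit))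
  qed (use pos in simp)
  have lim: "(\<lambda>k. (a k * d k + b (Suc k) * d k) / c) \<longlonglongrightarrow> 0"
    using tendsto_divide[OF tendsto_add[OF A B] tendsto_const[of c]] c by simp
  show ?thesis
  proof (rule tendsto_sandwich[OF _ _ tendsto_const lim])
    show "\<forall>\<^sub>F k in sequentially. d k \<le> (a k * d k + b (Suc k) * d k) / c"
      using c(2)
    proof eventually_elim
      case (elim k)
      then have "c * d k \<le> (a k + b (Suc k)) * d k"
        using nonneg by (intro mult_right_mono) auto
      then show ?case using c(1) by (simp add: le_divide_eq algebra_simps)
    qed
  qed (use nonneg in simp)
qed

text \<open>The Lyapunov values stay extended-valued because the starting point may lie outside the
  domain of \<open>g\<close>, which makes the value at \<open>k = 0\<close> infinite. The limits are
  asserted block by block, for blocks whose total weight is eventually bounded away from 0.\<close>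

theorem proposition3p5:
  fixes blk :: "'n::finite \<Rightarrow> nat" and N :: nat
    and f :: "real^'n \<Rightarrow> ereal" and g h :: "nat \<Rightarrow> real^'n \<Rightarrow> ereal" and C :: "(real^'n) set"
    and L \<sigma> \<delta> \<gamma>low \<alpha>lim :: "nat \<Rightarrow> real"
    and \<gamma> \<alpha> :: "nat \<Rightarrow> nat \<Rightarrow> real"
    and X :: "nat \<Rightarrow> nat \<Rightarrow> real^'n"
  assumes blocks: "range blk = {1..N}"
    and C: "C \<noteq> {}" "convex C" "open C"
    and A1: "\<And>i. i \<in> {1..N} \<Longrightarrow> proper_on (block_space blk i) (g i) \<and> lsc_on (block_space blk i) (g i)"
    and A2: "\<And>i. i \<in> {1..N} \<Longrightarrow> block_legendre blk i (h i)"
      "\<And>i. i \<in> {1..N} \<Longrightarrow> interior (edom (h i)) = interior (edom (h 1))"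
      "closure C \<subseteq> closure (edom (h 1))"
      "edom (gsum blk N g) \<inter> C \<noteq> {}"
    and A3: "C1_on (interior (edom (h 1))) f" "relatively_smooth blk N L h f"
    and A4: "argmin_set (closure C) (objective blk N f g) \<noteq> {}"
    and T: "\<And>i k x y z. \<lbrakk>i \<in> {1..N}; 0 < \<gamma> i k; \<gamma> i k < 1 / L i;
              x \<in> interior (edom (h i)); y \<in> interior (edom (h i));
              z \<in> prox_map blk i f (g i) (h i) (\<gamma> i k) (\<alpha> i k) x y\<rbrakk>
            \<Longrightarrow> replace_block blk i x z \<in> C"
    and alg: "bibpa blk N f g h \<gamma> \<alpha> X"
    and strong: "\<And>i. i \<in> {1..N} \<Longrightarrow> \<sigma> i > 0 \<and> block_strongly_convex blk i (\<sigma> i) (h i)"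
    and lim: "\<And>i. i \<in> {1..N} \<Longrightarrow> (\<lambda>k. \<alpha> i k) \<longlonglongrightarrow> \<alpha>lim i"
    and low: "\<And>i. i \<in> {1..N} \<Longrightarrow>
                0 < \<gamma>low i \<and> \<gamma>low i \<le> (\<sigma> i - 2 * \<bar>\<alpha>lim i\<bar>) / (\<sigma> i * L i)"
    and alpha: "\<And>i k. i \<in> {1..N} \<Longrightarrow> 0 \<le> \<alpha> i k \<and> \<bar>\<alpha> i k\<bar> < \<sigma> i / 2"
    and gamma: "\<And>i k. i \<in> {1..N} \<Longrightarrow>
                \<gamma>low i \<le> \<gamma> i k \<and> \<gamma> i k \<le> (\<sigma> i - 2 * \<bar>\<alpha> i k\<bar>) / (\<sigma> i * L i)"
    and delta: "\<And>i k. i \<in> {1..N} \<Longrightarrow>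
                \<bar>\<alpha> i k\<bar> / (\<sigma> i * \<gamma> i k) \<le> \<delta> i \<and>
                \<delta> i \<le> (1 - \<gamma> i k * L i) / \<gamma> i k - \<bar>\<alpha> i k\<bar> / (\<sigma> i * \<gamma> i k)"
  shows "(\<forall>k. lyapunov blk N f g h \<delta> (X (Suc k) 0) (X k 0)
                - lyapunov blk N f g h \<delta> (X k 0) (lag X k 0)
              \<le> - (\<Sum>i=1..N.
                    ereal (coeff_a (\<sigma> i) (L i) (\<delta> i) (\<gamma> i k) (\<alpha> i k))
                      * bregman (h i) (X k i) (X k (i - 1))
                  + ereal (coeff_b (\<sigma> i) (\<delta> i) (\<gamma> i k) (\<alpha> i k))
                      * bregman (h i) (lag X k i) (lag X k (i - 1))))
       \<and> decseq (\<lambda>k. lyapunov blk N f g h \<delta> (X k 0) (lag X k 0))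
       \<and> (\<forall>i\<in>{1..N}.
            (\<exists>c>0. \<forall>\<^sub>F k in sequentially.
               c \<le> coeff_a (\<sigma> i) (L i) (\<delta> i) (\<gamma> i k) (\<alpha> i k)
                   + coeff_b (\<sigma> i) (\<delta> i) (\<gamma> i (Suc k)) (\<alpha> i (Suc k)))
            \<longrightarrow> (\<lambda>k. bregman (h i) (X k i) (X k (i - 1))) \<longlonglongrightarrow> 0
                \<and> (\<lambda>k. norm (X k i - X k (i - 1))) \<longlonglongrightarrow> 0)"
proof -

  \<comment> \<open>Iterates as minimizers in the common interior\<close>
  have N: "1 \<le> N" using blocks by (metis UNIV_I atLeastAtMost_iff image_eqI order.trans)
  have L: "0 < L i" if "i \<in> {1..N}" for i
    using A3(2) that by (simp add: relatively_smooth_def)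
  have \<gamma>: "0 < \<gamma> i k" if "i \<in> {1..N}" for i k
    using low[OF that] gamma[OF that, of k] by linarith
  have reg: "regular (h i)" if "i \<in> {1..N}" for i
    using strong[OF that] by (simp add: block_strongly_convex_def)
  have gp: "proper_on (block_space blk i) (g i)" if "i \<in> {1..N}" for i
    using A1[OF that] by simp
  have "\<forall>i k. \<exists>z. i \<in> {1..N} \<longrightarrow>
      z \<in> prox_map blk i f (g i) (h i) (\<gamma> i k) (\<alpha> i k) (X k (i - 1)) (lag X k 0) \<and>
      X k i = replace_block blk i (X k (i - 1)) z"
    using alg unfolding bibpa_def by blast
  then obtain Z where Z: "\<And>i k. i \<in> {1..N} \<Longrightarrow>
      Z i k \<in> prox_map blk i f (g i) (h i) (\<gamma> i k) (\<alpha> i k) (X k (i - 1)) (lag X k 0)"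
    and XZ: "\<And>i k. i \<in> {1..N} \<Longrightarrow> X k i = replace_block blk i (X k (i - 1)) (Z i k)"
    by metis
  have XS: "X (Suc k) 0 = X k N" for k using alg by (simp add: bibpa_def)
  note Zfin = prox_map_finite[OF Z \<gamma> gp]
  have upd: "\<exists>z\<in>block_space blk i. X k i = replace_block blk i (X k (i - 1)) z" if "i \<in> {1..N}" for i k
    using Zfin(1) XZ that by blast
  \<comment> \<open>Every point is the base point of a later update: \<open>X k m\<close> of block
    \<open>m + 1\<close>, and \<open>X k N\<close> of block 1 in the next sweep.\<close>
  have inU: "X k m \<in> interior (edom (h i))" if i: "i \<in> {1..N}" and m: "m \<le> N" for i k m
  proof -
    have "\<exists>j\<in>{1..N}. X k m \<in> interior (edom (h j))"
    proof (cases "m = N")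
      case True
      then show ?thesis using Zfin(2)[of 1 "Suc k"] N XS[of k] by auto
    next
      case False
      then show ?thesis using Zfin(2)[of "Suc m" k] m by force
    qed
    then show ?thesis using A2(2) i by metis
  qed
  have lagU: "lag X k m \<in> interior (edom (h i))" if "i \<in> {1..N}" "m \<le> N" for i k m
    using inU[of i] that by (cases k) (auto simp: lag_def)

  \<comment> \<open>Bregman distances of the current and the previous sweep\<close>
  define D where "D k i = real_of_ereal (bregman (h i) (X k i) (X k (i - 1)))" for k i
  define P where "P k i = real_of_ereal (bregman (h i) (lag X k i) (lag X k (i - 1)))" for k i
  have breg: "bregman (h i) u v = ereal (real_of_ereal (bregman (h i) u v))"
    if "i \<in> {1..N}" "u \<in> interior (edom (h i))" "v \<in> interior (edom (h i))" for i u v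
  proof -
    have "u \<in> edom (h i)" using that interior_subset by blast
    then show ?thesis using bregman_eq[OF reg that(3)] that(1) by simp
  qed
  have bD: "bregman (h i) (X k i) (X k (i - 1)) = ereal (D k i)" if "i \<in> {1..N}" for i k
    unfolding D_def using that by (intro breg inU) auto
  have bP: "bregman (h i) (lag X k i) (lag X k (i - 1)) = ereal (P k i)" if "i \<in> {1..N}" for i k
    unfolding P_def using that by (intro breg lagU) auto
  have P_Suc: "P (Suc k) i = D k i" for k i
    by (simp add: P_def D_def lag_def)
  have P_0: "P 0 i = 0" if "i \<in> {1..N}" for i
  proof -
    have x0: "X 0 0 \<in> interior (edom (h i))" using inU[OF that, of 0 0] by simp
    then have "X 0 0 \<in> edom (h i)" using interior_subset by blast
    then show ?thesis using bregman_eq[OF reg x0] that by (simp add: P_def lag_def)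
  qed
  have Dlow: "\<sigma> i / 2 * (norm (X k i - X k (i - 1)))\<^sup>2 \<le> D k i" if i: "i \<in> {1..N}" for i k
  proof -
    have "block_strongly_convex blk i (\<sigma> i) (h i)" using strong[OF i] by simp
    from bregman_strongly_convex[OF this Zfin(2,1,3)[OF i i i], of k]
    have "ereal (\<sigma> i / 2 * (norm (X k i - X k (i - 1)))\<^sup>2) \<le> ereal (D k i)"
      unfolding XZ[OF i, of k, symmetric] bD[OF i] .
    then show ?thesis by simp
  qed
  have Dpos: "0 \<le> D k i" if "i \<in> {1..N}" for i k
    using Dlow[OF that, of k] strong[OF that] by (smt (verit) mult_nonneg_nonneg zero_le_power2 half_gt_zero)
  have Ppos: "0 \<le> P k i" if "i \<in> {1..N}" for i k
    using Dpos[OF that] P_Suc P_0[OF that] by (cases k) auto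
  \<comment> \<open>The extrapolation direction of block \<open>i\<close> is its previous update:
    before step \<open>i\<close> the block still has its value from the end of the last sweep, and
    in that sweep it changed only at step \<open>i\<close>. For \<open>k = 0\<close> it is 0 by the
    convention on \<open>lag\<close>.\<close>
  have Plow: "\<sigma> i / 2 * (norm (part blk i (X k (i - 1)) - part blk i (lag X k 0)))\<^sup>2 \<le> P k i"
    if i: "i \<in> {1..N}" for i k
  proof -
    have sw: "part blk i (X k m) = part blk i (if i \<le> m then X k i else X k 0)" if "m \<le> N" for k m
      by (rule sweep_part[of N blk "X k", OF upd i that])
    have im: "i - 1 \<le> N" "\<not> i \<le> i - 1" "i \<le> N" using i by auto
    show ?thesis
    proof (cases k)
      case 0
      then show ?thesis using sw[OF im(1), of 0] im P_0[OF i] by (simp add: lag_def)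
    next
      case (Suc m)
      have "part blk i (X k (i - 1)) - part blk i (lag X k 0) = part blk i (X m i) - part blk i (X m (i - 1))"
        using sw[OF im(1), of k] sw[OF im(1), of m] sw[of N m] im by (simp add: Suc lag_def XS)
      then have "\<sigma> i / 2 * (norm (part blk i (X k (i - 1)) - part blk i (lag X k 0)))\<^sup>2
          \<le> \<sigma> i / 2 * (norm (X m i - X m (i - 1)))\<^sup>2"
        using strong[OF i] norm_part_diff_le by (intro mult_left_mono power_mono) auto
      then show ?thesis using Dlow[OF i, of m] by (simp add: Suc P_Suc)
    qed
  qed

  \<comment> \<open>Descent of the objective, block by block\<close>
  let ?\<Phi> = "objective blk N f g"
  define A where "A i k = coeff_a (\<sigma> i) (L i) (\<delta> i) (\<gamma> i k) (\<alpha> i k)" for i k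
  define B where "B i k = coeff_b (\<sigma> i) (\<delta> i) (\<gamma> i k) (\<alpha> i k)" for i k
  \<comment> \<open>The decrease guaranteed by one update, rewritten through a_i, b_i and
    \<delta>_i: the coefficient of \<open>P\<close> is |\<alpha>|/(\<sigma>\<gamma>), so
    \<open>E\<close> may be negative.\<close>
  define E where "E k i = (A i k + \<delta> i) * D k i - (\<delta> i - B i k) * P k i" for k i
  have AB: "0 \<le> A i k" "0 \<le> B i k" if "i \<in> {1..N}" for i k
    using delta[OF that, of k] by (simp_all add: A_def B_def coeff_a_def coeff_b_def)
  have \<delta>: "0 \<le> \<delta> i" if i: "i \<in> {1..N}" for i
  proof -
    have "0 \<le> \<bar>\<alpha> i 0\<bar> / (\<sigma> i * \<gamma> i 0)" using strong[OF i] \<gamma>[OF i, of 0] by simp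
    then show ?thesis using delta[OF i, of 0] by linarith
  qed

  have step: "?\<Phi> (X k i) + ereal (E k i) \<le> ?\<Phi> (X k (i - 1))" if i: "i \<in> {1..N}" for i k
  proof -
    have U: "interior (edom (h i)) = interior (edom (h 1))" by (rule A2(2)[OF i])
    have "f (X k i) + g i (part blk i (X k i))
        + ereal (((1 - \<gamma> i k * L i) / \<gamma> i k - \<bar>\<alpha> i k\<bar> / (\<sigma> i * \<gamma> i k)) * real_of_ereal (bregman (h i) (X k i) (X k (i - 1)))
                 - \<bar>\<alpha> i k\<bar> / (\<sigma> i * \<gamma> i k) * P k i)
      \<le> f (X k (i - 1)) + g i (part blk i (X k (i - 1)))"
    proof (rule block_descent[OF _ _ _ _ gp[OF i] \<gamma>[OF i] _ Z[OF i] XZ[OF i] _ Plow[OF i]])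
      show "C1_on (interior (edom (h i))) f" using A3(1) U by simp
      show "econvex_on {z \<in> block_space blk i. replace_block blk i x z \<in> interior (edom (h i))}
          (\<lambda>z. ereal (L i) * h i (replace_block blk i x z) - f (replace_block blk i x z))"
        if "x \<in> interior (edom (h i))" for x
        using A3(2) i that unfolding relatively_smooth_def by blast
    qed (use strong[OF i] alpha[OF i] inU[OF i] i in auto)
    then have "f (X k i) + g i (part blk i (X k i)) + ereal (E k i)
      \<le> f (X k (i - 1)) + g i (part blk i (X k (i - 1)))"
      by (simp add: E_def A_def B_def D_def coeff_a_def coeff_b_def)
    then show ?thesis
      using objective_update[OF Zfin(1)[OF i i i, of k] i, where f = f and g = g and x = "X k (i - 1)"] XZ[OF i, of k] by simp
  qed
  \<comment> \<open>Partial sweeps are kept: \<open>m = N\<close> gives the Lyapunov descent, while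
    \<open>m = i\<close> is used where only \<open>X k i\<close> is known to lie in
    \<open>C\<close>.\<close>
  have sweep: "?\<Phi> (X k m) + ereal (\<Sum>j=1..m. E k j) \<le> ?\<Phi> (X k 0)" if "m \<le> N" for k m
    using that
  proof (induction m)
    case 0
    then show ?case by (simp add: zero_ereal_def[symmetric])
  next
    case (Suc m)
    have "?\<Phi> (X k (Suc m)) + ereal (\<Sum>j=1..Suc m. E k j)
        = ?\<Phi> (X k (Suc m)) + ereal (E k (Suc m)) + ereal (\<Sum>j=1..m. E k j)"
      by (simp add: add.assoc) (simp only: plus_ereal.simps(1)[symmetric] ac_simps)
    also have "\<dots> \<le> ?\<Phi> (X k m) + ereal (\<Sum>j=1..m. E k j)"
      using step[of "Suc m" k] Suc.prems by (intro add_right_mono) simp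
    also have "\<dots> \<le> ?\<Phi> (X k 0)" using Suc by simp
    finally show ?case .
  qed

  \<comment> \<open>Descent and finiteness of the Lyapunov values\<close>
  define W where "W k = lyapunov blk N f g h \<delta> (X k 0) (lag X k 0)" for k
  have mixlag: "mix blk i (X k 0) (lag X k 0) = lag X k i" if "i \<le> N" for i k
  proof (cases k)
    case 0
    then show ?thesis by (simp add: lag_def mix_def vec_eq_iff)
  next
    case (Suc m)
    then show ?thesis
      using sweep_mix[of N blk "X m", OF upd blocks that] by (simp add: lag_def XS)
  qed
  have W: "W k = ?\<Phi> (X k 0) + ereal (\<Sum>i=1..N. \<delta> i * P k i)" for k
  proof -
    have "(\<Sum>i=1..N. ereal (\<delta> i) * bregman (h i) (mix blk i (X k 0) (lag X k 0)) (mix blk (i - 1) (X k 0) (lag X k 0)))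
        = (\<Sum>i=1..N. ereal (\<delta> i * P k i))"
    proof (intro sum.cong refl)
      fix i assume i: "i \<in> {1..N}"
      then show "ereal (\<delta> i) * bregman (h i) (mix blk i (X k 0) (lag X k 0)) (mix blk (i - 1) (X k 0) (lag X k 0))
          = ereal (\<delta> i * P k i)"
        using bP[OF i, of k] mixlag[of i k] mixlag[of "i - 1" k] by (simp add: le_diff_conv)
    qed
    then show ?thesis by (simp add: W_def lyapunov_def)
  qed
  have dec: "W (Suc k) + ereal (\<Sum>i=1..N. A i k * D k i + B i k * P k i) \<le> W k" for k
  proof -
    \<comment> \<open>Here \<delta>_i does its work: the old term \<open>\<delta> i * P k i\<close>
      covers the negative part of \<open>E\<close>, and \<open>\<delta> i * D k i\<close> is handed
      on to the next Lyapunov value.\<close>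
    have eq: "(\<Sum>i=1..N. \<delta> i * D k i) + (\<Sum>i=1..N. A i k * D k i + B i k * P k i)
        = (\<Sum>i=1..N. E k i) + (\<Sum>i=1..N. \<delta> i * P k i)"
      unfolding sum.distrib[symmetric] by (intro sum.cong) (auto simp: E_def algebra_simps)
    have "W (Suc k) + ereal (\<Sum>i=1..N. A i k * D k i + B i k * P k i)
        = ?\<Phi> (X k N) + ereal ((\<Sum>i=1..N. \<delta> i * D k i) + (\<Sum>i=1..N. A i k * D k i + B i k * P k i))"
      by (simp add: W XS P_Suc add.assoc)
    also have "\<dots> = ?\<Phi> (X k N) + ereal (\<Sum>i=1..N. E k i) + ereal (\<Sum>i=1..N. \<delta> i * P k i)"
      unfolding eq by (simp add: add.assoc)
    also have "\<dots> \<le> W k"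
      unfolding W using sweep[of N k] by (intro add_right_mono) simp
    finally show ?thesis .
  qed
  \<comment> \<open>After one full sweep every block is a subproblem minimizer, so each g_i is
    finite there; \<open>W 0\<close> is left out.\<close>
  have Wfin: "\<bar>W (Suc k)\<bar> \<noteq> \<infinity>" for k
  proof -
    have "\<bar>f (X k N)\<bar> \<noteq> \<infinity>"
      using C1_on_finite[OF A3(1)] inU[of 1 N k] N by simp
    moreover have "\<bar>gsum blk N g (X k N)\<bar> \<noteq> \<infinity>"
    proof -
      have "gsum blk N g (X k N) = (\<Sum>i=1..N. ereal (real_of_ereal (g i (Z i k))))"
        unfolding gsum_def
      proof (intro sum.cong refl)
        fix i assume i: "i \<in> {1..N}"
        have "part blk i (X k N) = part blk i (X k i)"
          using sweep_part[of N blk "X k", OF upd i order.refl] i by simp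
        also have "\<dots> = Z i k"
          using part_replace_block[OF Zfin(1)[OF i i i]] XZ[OF i, of k] by simp
        finally show "g i (part blk i (X k N)) = ereal (real_of_ereal (g i (Z i k)))"
          using Zfin(4)[OF i i i, of k] by (simp add: ereal_real)
      qed
      then show ?thesis by simp
    qed
    ultimately show ?thesis
      unfolding W XS objective_def by auto
  qed

  \<comment> \<open>The descent inequality and monotonicity\<close>
  have "lyapunov blk N f g h \<delta> (X (Suc k) 0) (X k 0)
                - lyapunov blk N f g h \<delta> (X k 0) (lag X k 0)
              \<le> - (\<Sum>i=1..N.
                    ereal (coeff_a (\<sigma> i) (L i) (\<delta> i) (\<gamma> i k) (\<alpha> i k))
                      * bregman (h i) (X k i) (X k (i - 1))
                  + ereal (coeff_b (\<sigma> i) (\<delta> i) (\<gamma> i k) (\<alpha> i k))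
                      * bregman (h i) (lag X k i) (lag X k (i - 1)))" (is "?l - ?r \<le> - ?S") for k
  proof -
    have "?S = (\<Sum>i=1..N. ereal (A i k * D k i + B i k * P k i))"
      by (intro sum.cong refl) (simp only: A_def B_def bD bP times_ereal.simps plus_ereal.simps)
    then have S: "?S = ereal (\<Sum>i=1..N. A i k * D k i + B i k * P k i)" by simp
    have "?l = W (Suc k)" by (simp add: W_def lag_def)
    moreover obtain u where u: "W (Suc k) = ereal u" using Wfin[of k] by auto
    \<comment> \<open>If \<open>W k\<close> is infinite, the left-hand side is minus infinity;
      \<open>dec\<close> with a finite \<open>W (Suc k)\<close> excludes \<open>W k\<close> being
      minus infinity.\<close>
    ultimately show ?thesis
      using dec[of k] unfolding S W_def[symmetric] by (cases "W k") auto
  qed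
  moreover have "decseq W"
  proof (rule decseq_SucI)
    fix k
    have "0 \<le> ereal (\<Sum>i=1..N. A i k * D k i + B i k * P k i)"
      using AB Dpos Ppos by (auto intro!: sum_nonneg)
    from add_left_mono[OF this, of "W (Suc k)"]
    show "W (Suc k) \<le> W k" using dec[of k] by simp
  qed

  \<comment> \<open>Vanishing of the updates of one block\<close>
  moreover have "(\<lambda>k. bregman (h i) (X k i) (X k (i - 1))) \<longlonglongrightarrow> 0
                \<and> (\<lambda>k. norm (X k i - X k (i - 1))) \<longlonglongrightarrow> 0"
    if i: "i \<in> {1..N}" and c: "c > 0" "\<forall>\<^sub>F k in sequentially. c \<le> A i k + B i (Suc k)" for i c
  proof -
    obtain z0 where z0: "z0 \<in> closure C" "?\<Phi> z0 < \<infinity>" "\<And>y. y \<in> closure C \<Longrightarrow> ?\<Phi> z0 \<le> ?\<Phi> y"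
      using A4 by (auto simp: argmin_set_def is_arg_min_def not_less)
    have "?\<Phi> z0 \<noteq> -\<infinity>"
    proof -
      have "f z0 \<noteq> -\<infinity>" using A3(2) by (auto simp: relatively_smooth_def proper_on_def)
      moreover have "gsum blk N g z0 \<noteq> -\<infinity>"
        using gp part_in_block_space unfolding gsum_def proper_on_def
        by (intro sum_ereal_neq_MInfty) blast
      ultimately show ?thesis by (simp add: objective_def)
    qed
    with z0(2) obtain M where M: "?\<Phi> z0 = ereal M" by (cases "?\<Phi> z0") auto
    have WM: "\<forall>\<^sub>F k in sequentially. ereal M \<le> W k"
      using c(2)
    proof eventually_elim
      case (elim k)
      \<comment> \<open>In \<open>A i k + B i (Suc k)\<close> the two \<delta>_i cancel, leaving (1
        - \<gamma>L)/\<gamma> minus nonnegative terms. Positivity therefore gives the strict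
        step-size bound required by \<open>T\<close>.\<close>
      have "0 \<le> \<bar>\<alpha> i k\<bar> / (\<sigma> i * \<gamma> i k)" "0 \<le> \<bar>\<alpha> i (Suc k)\<bar> / (\<sigma> i * \<gamma> i (Suc k))"
        using strong[OF i] \<gamma>[OF i, of k] \<gamma>[OF i, of "Suc k"] by simp_all
      then have "0 < (1 - \<gamma> i k * L i) / \<gamma> i k"
        using elim c(1) by (simp add: A_def B_def coeff_a_def coeff_b_def)
      then have "\<gamma> i k < 1 / L i"
        using \<gamma>[OF i, of k] L[OF i] by (simp add: zero_less_divide_iff less_divide_eq)
      from T[OF i \<gamma>[OF i] this inU[OF i] lagU[OF i] Z[OF i]]
      have "X k i \<in> C" using XZ[OF i, of k] i by auto
      then have "ereal M \<le> ?\<Phi> (X k i)" using z0(3) M closure_subset by (metis subsetD)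
      \<comment> \<open>Each \<open>E k j\<close> is at least \<open>- (\<delta> j * P k j)\<close>,
        and the Lyapunov terms compensate for this in all blocks up to \<open>i\<close>.\<close>
      moreover have "0 \<le> (\<Sum>j=1..i. E k j) + (\<Sum>j=1..N. \<delta> j * P k j)"
      proof -
        have iN: "{1..i} \<subseteq> {1..N}" using i by auto
        have "- (\<delta> j * P k j) \<le> E k j" if "j \<in> {1..i}" for j
        proof -
          have j: "j \<in> {1..N}" using that iN by blast
          have "0 \<le> (A j k + \<delta> j) * D k j" "0 \<le> B j k * P k j"
            using AB[OF j] \<delta>[OF j] Dpos[OF j] Ppos[OF j] by simp_all
          then show ?thesis by (simp add: E_def algebra_simps)
        qed
        then have "(\<Sum>j=1..i. - (\<delta> j * P k j)) \<le> (\<Sum>j=1..i. E k j)"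
          by (rule sum_mono)
        moreover have "(\<Sum>j=1..i. \<delta> j * P k j) \<le> (\<Sum>j=1..N. \<delta> j * P k j)"
          using iN \<delta> Ppos by (intro sum_mono2) auto
        ultimately show ?thesis by (simp add: sum_negf)
      qed
      ultimately have "ereal M + 0 \<le> ?\<Phi> (X k i) + ereal ((\<Sum>j=1..i. E k j) + (\<Sum>j=1..N. \<delta> j * P k j))"
        by (intro add_mono) auto
      also have "\<dots> = ?\<Phi> (X k i) + ereal (\<Sum>j=1..i. E k j) + ereal (\<Sum>j=1..N. \<delta> j * P k j)"
        by (simp add: add.assoc)
      also have "\<dots> \<le> W k"
        unfolding W using sweep[of i k] i by (intro add_right_mono) simp
      finally show ?case by simp
    qed
    \<comment> \<open>Shifted by one to start at the first value known to be finite; with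
      \<open>P (Suc k) i = D k i\<close> the indices then match the limit lemma.\<close>
    define w where "w k = real_of_ereal (W (Suc k))" for k
    have w: "W (Suc k) = ereal (w k)" for k
      using Wfin[of k] by (simp add: w_def ereal_real)
    have lim: "(\<lambda>k. D k i) \<longlonglongrightarrow> 0"
    proof (rule weighted_decrease_tendsto_zero[OF _ AB[OF i] Dpos[OF i] _ c])
      show "w (Suc k) + (A i (Suc k) * D (Suc k) i + B i (Suc k) * D k i) \<le> w k" for k
      proof -
        \<comment> \<open>All summands are nonnegative, so the term of block \<open>i\<close> alone
          may be retained.\<close>
        have "A i (Suc k) * D (Suc k) i + B i (Suc k) * P (Suc k) i
            \<le> (\<Sum>j=1..N. A j (Suc k) * D (Suc k) j + B j (Suc k) * P (Suc k) j)"
          using i AB Dpos Ppos by (intro member_le_sum) auto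
        then show ?thesis using dec[of "Suc k"] by (simp add: w P_Suc)
      qed
      show "\<forall>\<^sub>F k in sequentially. M \<le> w k"
        using eventually_sequentially_Suc[THEN iffD2, OF WM] by (simp add: w)
    qed
    have lim': "(\<lambda>k. 2 / \<sigma> i * D k i) \<longlonglongrightarrow> 0"
      by (rule tendsto_mult_right_zero[OF lim])
    have "(\<lambda>k. (norm (X k i - X k (i - 1)))\<^sup>2) \<longlonglongrightarrow> 0"
    proof (rule tendsto_sandwich[OF _ _ tendsto_const lim'])
      show "\<forall>\<^sub>F k in sequentially. (norm (X k i - X k (i - 1)))\<^sup>2 \<le> 2 / \<sigma> i * D k i"
        using Dlow[OF i] strong[OF i] by (intro always_eventually allI) (simp add: field_simps)
    qed simp
    then have "(\<lambda>k. norm (X k i - X k (i - 1))) \<longlonglongrightarrow> 0"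
      by simp
    moreover have "(\<lambda>k. bregman (h i) (X k i) (X k (i - 1))) \<longlonglongrightarrow> 0"
      using lim unfolding bD[OF i] zero_ereal_def by simp
    ultimately show ?thesis by simp
  qed
  ultimately show ?thesis
    unfolding W_def A_def B_def by blast
qed

end
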